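(* There exists $n_0\in\mathbb{N}$ such that for all $n\ge n_0$ the following holds. If $\mathcal{A}\subset S_n$ is a family of permutations such that no two permutations in $\mathcal{A}$ agree at exactly one point, then $|\mathcal{A}|\le (n-2)!$, and equality holds only if $\mathcal{A}$ is a $2$-coset of $S_n$.
   Context: $S_n$ is the symmetric group on $[n]=\{1,\dots,n\}$. Two permutations $\sigma,\tau\in S_n$ agree at exactly $k$ points if $\#\{i\in[n]:\sigma(i)=\tau(i)\}=k$. A $2$-coset of $S_n$ is a coset of the pointwise stabiliser of two points, i.e. a set of the form $\{\sigma\in S_n:\sigma(i)=j,\ \sigma(k)=l\}$ with $i\neq k$, $j\neq l$. *)

theory Defs
  imports "HOL-Combinatorics.Permutations"
begin

definition Sym :: "nat \<Rightarrow> (nat \<Rightarrow> nat) set" where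
  "Sym n = {\<sigma>. \<sigma> permutes {1..n}}"

definition agree :: "nat \<Rightarrow> (nat \<Rightarrow> nat) \<Rightarrow> (nat \<Rightarrow> nat) \<Rightarrow> nat" where
  "agree n \<sigma> \<tau> = card {i \<in> {1..n}. \<sigma> i = \<tau> i}"

definition two_coset :: "nat \<Rightarrow> (nat \<Rightarrow> nat) set \<Rightarrow> bool" where
  "two_coset n A \<longleftrightarrow> (\<exists>i\<in>{1..n}. \<exists>j\<in>{1..n}. \<exists>k\<in>{1..n}. \<exists>l\<in>{1..n}.
      i \<noteq> k \<and> j \<noteq> l \<and> A = {\<sigma> \<in> Sym n. \<sigma> i = j \<and> \<sigma> k = l})"

end

theory Submission
  imports Defs "HOL-Real_Asymp.Real_Asymp"
begin

text \<open>
  Identify a permutation with the set of pairs \<open>(i, \<sigma> i)\<close>. Suppose \<open>F\<^sub>1\<close> and \<open>F\<^sub>2\<close> are families of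
  permutations extending partial permutations \<open>S\<^sub>1\<close> and \<open>S\<^sub>2\<close> of bounded size with
  \<open>card (S\<^sub>1 \<inter> S\<^sub>2) \<le> 1\<close>, that in each \<open>F\<^sub>i\<close> every pair outside \<open>S\<^sub>i\<close> occurs in a fraction at most
  \<open>w = n powr (-3/5)\<close> of the members, and that \<open>F\<^sub>1\<close> has polynomial density. Then some member of
  \<open>F\<^sub>1\<close> and some member of \<open>F\<^sub>2\<close> agree exactly once: the probability \<open>h \<sigma>\<close> that \<open>\<sigma>\<close> has the right
  number of agreements with a random \<open>\<tau>\<close> in \<open>F\<^sub>2\<close> changes by \<open>O(w)\<close> under a transposition, so on the
  extensions of \<open>S\<^sub>1\<close> it is exponentially concentrated around its mean, which is bounded below by a
  constant; it cannot vanish on a set of polynomial density.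

  Consequently the bases \<open>S\<close> of such spread subfamilies of \<open>A\<close> pairwise meet in at least two pairs. A
  density increment shows that all but at most \<open>fact n / n ^ 4\<close> members of \<open>A\<close> contain a base. Either
  the bases are all covered by boundedly many triples, and \<open>A\<close> is small, or they share two common
  pairs; then \<open>A\<close> is almost contained in a 2-coset, and a single member outside of that coset
  excludes a constant fraction of it.
\<close>

section \<open>Concentration on the symmetric group\<close>

text \<open>For negative \<open>x\<close> put \<open>y = - x\<close>: the product of
  \<open>1 - y + y\<^sup>2\<close> with the quadratic Taylor lower bound of \<open>exp y\<close> is
  at least 1. The exact linear term is what cancels when the bound is averaged around a
  mean.\<close>

lemma exp_le_one_plus_square:
  fixes x :: real
  assumes "\<bar>x\<bar> \<le> 1"
  shows "exp x \<le> 1 + x + x\<^sup>2"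
proof (cases "x \<ge> 0")
  case True
  then show ?thesis using assms exp_bound[of x] by simp
next
  case False
  define y where "y = - x"
  have y: "0 \<le> y" using False by (simp add: y_def)
  have "1 \<le> (1 - y + y\<^sup>2) * (1 + y + y\<^sup>2 / 2)"
  proof -
    have "(1 - y + y\<^sup>2) * (1 + y + y\<^sup>2 / 2) = 1 + (y\<^sup>2 + y^3 + y^4) / 2"
      by (simp add: field_simps power2_eq_square power3_eq_cube power4_eq_xxxx)
    then show ?thesis using y by simp
  qed
  also have "\<dots> \<le> (1 - y + y\<^sup>2) * exp y"
  proof (rule mult_left_mono)
    show "1 + y + y\<^sup>2 / 2 \<le> exp y" using exp_lower_Taylor_quadratic[OF y] .
    have "1 - y + y\<^sup>2 = (y - 1/2)\<^sup>2 + 3/4" by (simp add: power2_eq_square algebra_simps)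
    then show "0 \<le> 1 - y + y\<^sup>2" by simp
  qed
  finally have "exp (- y) \<le> 1 - y + y\<^sup>2"
    by (simp add: exp_minus field_simps)
  then show ?thesis by (simp add: y_def)
qed

text \<open>
  The images are revealed one at a time. Two conditional means differ by at most \<open>2 * L\<close> because
  \<open>transpose a b \<circ> p\<close> and \<open>transpose a b' \<circ> p\<close> are both one transposition away from \<open>p\<close>.
\<close>

lemma permutation_mgf_bound:
  fixes h :: "('a \<Rightarrow> 'a) \<Rightarrow> real" and L t :: real
  assumes "finite S" "0 \<le> L" "2 * \<bar>t\<bar> * L \<le> 1"
    and "\<And>p c d. p permutes S \<Longrightarrow> c \<in> S \<Longrightarrow> d \<in> S \<Longrightarrow> \<bar>h (transpose c d \<circ> p) - h p\<bar> \<le> L"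
  shows "(\<Sum>p | p permutes S. exp (t * (h p - (\<Sum>p | p permutes S. h p) / fact (card S))))
           \<le> fact (card S) * exp (4 * card S * L\<^sup>2 * t\<^sup>2)"
  using assms(1,4)
proof (induction S arbitrary: h rule: finite_induct)
  case empty
  then show ?case by simp
next
  case (insert a S)
  define k where "k = card S"
  define P where "P = {p. p permutes S}"
  \<comment> \<open>\<open>g b\<close> is \<open>h\<close> on the permutations of
    \<open>insert a S\<close> that send \<open>a\<close> to \<open>b\<close>, parametrised by the
    permutations of \<open>S\<close>, and \<open>m b\<close> is the corresponding conditional
    mean.\<close>
  define g where "g = (\<lambda>b p. h (transpose a b \<circ> p))"
  define m where "m = (\<lambda>b. (\<Sum>p\<in>P. g b p) / fact k)"
  define \<mu> where "\<mu> = (\<Sum>p | p permutes insert a S. h p) / fact (card (insert a S))"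
  have cP: "card P = fact k" and fP: "finite P"
    using insert.hyps by (auto simp: P_def k_def card_permutations finite_permutations)
  have ci: "card (insert a S) = Suc k" using insert.hyps by (simp add: k_def)
  have perm: "transpose a b \<circ> p permutes insert a S" if "p \<in> P" "b \<in> insert a S" for b p
    using that permutes_subset[of p S "insert a S"]
    by (intro permutes_compose) (auto simp: P_def intro: permutes_swap_id)
  have lip: "\<bar>g b (transpose c d \<circ> p) - g b p\<bar> \<le> L"
    if "p permutes S" "c \<in> S" "d \<in> S" "b \<in> insert a S" for b c d p
  proof -
    define u v where "u = transpose a b c" and "v = transpose a b d"
    \<comment> \<open>Conjugation by \<open>transpose a b\<close> turns the transposition of
      \<open>c\<close> and \<open>d\<close> into that of their images, so each \<open>g b\<close>
      inherits the Lipschitz constant of \<open>h\<close>.\<close>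
    have eq: "transpose a b \<circ> (transpose c d \<circ> p) = transpose u v \<circ> (transpose a b \<circ> p)"
      by (auto simp: fun_eq_iff u_def v_def transpose_def)
    have "u \<in> insert a S" "v \<in> insert a S"
      using that by (auto simp: u_def v_def transpose_def)
    then show ?thesis unfolding g_def eq
      by (intro insert.prems perm) (use that in \<open>auto simp: P_def\<close>)
  qed
  have IH: "(\<Sum>p\<in>P. exp (t * (g b p - m b))) \<le> fact k * exp (4 * k * L\<^sup>2 * t\<^sup>2)"
    if "b \<in> insert a S" for b
    using insert.IH[of "g b", OF lip[where b = b]] that unfolding P_def m_def k_def by simp
  have close: "\<bar>g b p - g b' p\<bar> \<le> 2 * L"
    if "p \<in> P" "b \<in> insert a S" "b' \<in> insert a S" for p b b'
  proof -
    have *: "\<bar>g b p - h p\<bar> \<le> L" if "b \<in> insert a S" for b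
      unfolding g_def
      by (intro insert.prems) (use that \<open>p \<in> P\<close> permutes_subset[of p S "insert a S"] in \<open>auto simp: P_def\<close>)
    from *[OF that(2)] *[OF that(3)] show ?thesis by linarith
  qed
  have mclose: "\<bar>m b - m b'\<bar> \<le> 2 * L" if "b \<in> insert a S" "b' \<in> insert a S" for b b'
  proof -
    have "\<bar>\<Sum>p\<in>P. g b p - g b' p\<bar> \<le> (\<Sum>p\<in>P. \<bar>g b p - g b' p\<bar>)" by (rule sum_abs)
    also have "\<dots> \<le> (\<Sum>p\<in>P. 2 * L)" by (intro sum_mono close that)
    also have "\<dots> = 2 * L * fact k" by (simp add: cP)
    finally have "\<bar>(\<Sum>p\<in>P. g b p) - (\<Sum>p\<in>P. g b' p)\<bar> \<le> 2 * L * fact k"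
      by (simp add: sum_subtractf)
    moreover have "m b - m b' = ((\<Sum>p\<in>P. g b p) - (\<Sum>p\<in>P. g b' p)) / fact k"
      by (simp add: m_def diff_divide_distrib)
    ultimately show ?thesis by (simp add: divide_le_eq)
  qed
  have split: "(\<Sum>p | p permutes insert a S. f p) = (\<Sum>b\<in>insert a S. \<Sum>p\<in>P. f (transpose a b \<circ> p))"
    for f :: "('a \<Rightarrow> 'a) \<Rightarrow> real"
    using sum_over_permutations_insert[OF insert.hyps] by (simp add: P_def)
  have mean: "(\<Sum>b\<in>insert a S. m b) = Suc k * \<mu>"
  proof -
    have "\<mu> = (\<Sum>b\<in>insert a S. \<Sum>p\<in>P. g b p) / fact (Suc k)"
      by (simp add: \<mu>_def split ci g_def del: fact_Suc)
    also have "\<dots> = (\<Sum>b\<in>insert a S. m b) / Suc k"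
      by (simp add: m_def sum_divide_distrib[symmetric] field_simps del: sum.insert)
    finally show ?thesis by simp
  qed
  have dev: "\<bar>m b - \<mu>\<bar> \<le> 2 * L" if b: "b \<in> insert a S" for b
  proof -
    have "Suc k * (m b - \<mu>) = (\<Sum>b'\<in>insert a S. m b - m b')"
      using ci mean by (simp add: sum_subtractf algebra_simps del: sum.insert)
    then have "\<bar>Suc k * (m b - \<mu>)\<bar> \<le> (\<Sum>b'\<in>insert a S. \<bar>m b - m b'\<bar>)" by simp
    also have "\<dots> \<le> (\<Sum>b'\<in>insert a S. 2 * L)" by (intro sum_mono mclose b) 
    also have "\<dots> = Suc k * (2 * L)" using ci by (simp del: sum.insert)
    finally show ?thesis by (simp only: abs_mult abs_of_nat mult_le_cancel_left_pos of_nat_0_less_iff zero_less_Suc)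
  qed
  have "(\<Sum>p | p permutes insert a S. exp (t * (h p - \<mu>)))
      = (\<Sum>b\<in>insert a S. exp (t * (m b - \<mu>)) * (\<Sum>p\<in>P. exp (t * (g b p - m b))))"
    unfolding split by (intro sum.cong refl) 
      (simp add: sum_distrib_left g_def exp_add[symmetric] algebra_simps)
  also have "\<dots> \<le> (\<Sum>b\<in>insert a S. exp (t * (m b - \<mu>)) * (fact k * exp (4 * k * L\<^sup>2 * t\<^sup>2)))"
    by (intro sum_mono mult_left_mono IH) auto
  also have "\<dots> = (fact k * exp (4 * k * L\<^sup>2 * t\<^sup>2)) * (\<Sum>b\<in>insert a S. exp (t * (m b - \<mu>)))"
    unfolding sum_distrib_left by (intro sum.cong refl mult.commute)
  \<comment> \<open>The quadratic bound on \<open>exp\<close> applies because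
    \<open>2 * \<bar>t\<bar> * L \<le> 1\<close>. The linear terms sum to zero since
    \<open>\<mu>\<close> is the average of the \<open>m b\<close>, so revealing one image costs only
    the factor \<open>exp (4 * L\<^sup>2 * t\<^sup>2)\<close>.\<close>
  also have "(\<Sum>b\<in>insert a S. exp (t * (m b - \<mu>)))
      \<le> (\<Sum>b\<in>insert a S. 1 + t * (m b - \<mu>) + 4 * L\<^sup>2 * t\<^sup>2)"
  proof (rule sum_mono)
    fix b assume b: "b \<in> insert a S"
    have le: "\<bar>t * (m b - \<mu>)\<bar> \<le> 2 * \<bar>t\<bar> * L"
      using mult_left_mono[OF dev[OF b], of "\<bar>t\<bar>"] by (simp only: abs_mult mult_ac)
    have "(t * (m b - \<mu>))\<^sup>2 \<le> (2 * \<bar>t\<bar> * L)\<^sup>2"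
      using le by (metis abs_ge_zero power2_abs power_mono)
    then show "exp (t * (m b - \<mu>)) \<le> 1 + t * (m b - \<mu>) + 4 * L\<^sup>2 * t\<^sup>2"
      using exp_le_one_plus_square[of "t * (m b - \<mu>)"] le assms(3)
      by (simp add: algebra_simps)
  qed
  also have "\<dots> = Suc k * (1 + 4 * L\<^sup>2 * t\<^sup>2)"
  proof -
    have "(\<Sum>b\<in>insert a S. t * (m b - \<mu>)) = t * ((\<Sum>b\<in>insert a S. m b) - Suc k * \<mu>)"
      using ci by (simp add: sum_distrib_left[symmetric] sum_subtractf del: sum.insert)
    then have "(\<Sum>b\<in>insert a S. t * (m b - \<mu>)) = 0" by (simp add: mean del: sum.insert)
    then show ?thesis by (simp only: sum.distrib sum_constant ci) (simp add: algebra_simps)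
  qed
  also have "\<dots> \<le> Suc k * exp (4 * L\<^sup>2 * t\<^sup>2)"
    by (intro mult_left_mono exp_ge_add_one_self) auto
  finally have "(\<Sum>p | p permutes insert a S. exp (t * (h p - \<mu>)))
     \<le> fact k * exp (4 * k * L\<^sup>2 * t\<^sup>2) * (Suc k * exp (4 * L\<^sup>2 * t\<^sup>2))"
    by (simp add: mult_left_mono)
  also have "\<dots> = fact (Suc k) * exp (4 * Suc k * L\<^sup>2 * t\<^sup>2)"
    by (simp add: exp_add[symmetric] algebra_simps)
  finally show ?case unfolding \<mu>_def ci .
qed

section \<open>Extensions of partial permutations\<close>

definition perm_graph :: "nat \<Rightarrow> (nat \<Rightarrow> nat) \<Rightarrow> (nat \<times> nat) set" where
  "perm_graph n \<sigma> = (\<lambda>i. (i, \<sigma> i)) ` {1..n}"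

definition partial_perm :: "nat \<Rightarrow> (nat \<times> nat) set \<Rightarrow> bool" where
  "partial_perm n X \<longleftrightarrow> X \<subseteq> {1..n} \<times> {1..n} \<and> inj_on fst X \<and> inj_on snd X"

definition extensions :: "nat \<Rightarrow> (nat \<times> nat) set \<Rightarrow> (nat \<Rightarrow> nat) set" where
  "extensions n X = {\<sigma> \<in> Sym n. X \<subseteq> perm_graph n \<sigma>}"

lemma mem_perm_graph: "x \<in> perm_graph n \<sigma> \<longleftrightarrow> fst x \<in> {1..n} \<and> \<sigma> (fst x) = snd x"
  by (cases x) (auto simp: perm_graph_def)

lemma finite_perm_graph [simp]: "finite (perm_graph n \<sigma>)"
  by (simp add: perm_graph_def)

lemma card_perm_graph [simp]: "card (perm_graph n \<sigma>) = n"
  by (simp add: perm_graph_def card_image inj_on_def)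

lemma finite_Sym [simp]: "finite (Sym n)"
  by (simp add: Sym_def finite_permutations)

lemma finite_extensions [simp]: "finite (extensions n X)"
  by (simp add: extensions_def)

lemma agree_eq_card_Int: "agree n \<sigma> \<tau> = card (perm_graph n \<sigma> \<inter> perm_graph n \<tau>)"
proof -
  have "perm_graph n \<sigma> \<inter> perm_graph n \<tau> = (\<lambda>i. (i, \<sigma> i)) ` {i \<in> {1..n}. \<sigma> i = \<tau> i}"
    by (auto simp: perm_graph_def)
  then show ?thesis by (simp add: agree_def card_image inj_on_def)
qed

lemma partial_perm_perm_graph:
  assumes "\<sigma> \<in> Sym n"
  shows "partial_perm n (perm_graph n \<sigma>)"
proof -
  have "\<sigma> permutes {1..n}" using assms by (simp add: Sym_def)
  then have "\<sigma> i \<in> {1..n}" if "i \<in> {1..n}" for i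
    using that by (simp only: permutes_in_image)
  moreover have "inj \<sigma>" using \<open>\<sigma> permutes {1..n}\<close> by (rule permutes_inj)
  ultimately show ?thesis
    by (force simp: partial_perm_def perm_graph_def inj_on_def)
qed

lemma partial_perm_subset: "partial_perm n X \<Longrightarrow> Y \<subseteq> X \<Longrightarrow> partial_perm n Y"
  unfolding partial_perm_def by (meson inj_on_subset order_trans)

lemma partial_perm_finite: "partial_perm n X \<Longrightarrow> finite X"
  unfolding partial_perm_def by (meson finite_SigmaI finite_atLeastAtMost finite_subset)

lemma partial_perm_card_le:
  assumes "partial_perm n X"
  shows "card X \<le> n"
proof -
  have "card X = card (fst ` X)" "fst ` X \<subseteq> {1..n}"
    using assms by (auto simp: partial_perm_def card_image)
  then show ?thesis using card_mono[of "{1..n}" "fst ` X"] by simp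
qed

lemma partial_perm_extends:
  assumes "partial_perm n X"
  obtains \<sigma> where "\<sigma> \<in> Sym n" "X \<subseteq> perm_graph n \<sigma>"
proof -
  define D E where "D = fst ` X" and "E = snd ` X"
  have sub: "D \<subseteq> {1..n}" "E \<subseteq> {1..n}"
    using assms by (auto simp: partial_perm_def D_def E_def)
  then have fin: "finite D" "finite E" by (auto intro: finite_subset)
  have "bij_betw fst X D" "bij_betw snd X E"
    using assms by (auto simp: partial_perm_def D_def E_def bij_betw_def)
  then have f: "bij_betw (snd \<circ> inv_into X fst) D E"
    by (meson bij_betw_inv_into bij_betw_trans)
  have "card D = card E" using f by (rule bij_betw_same_card)
  then have "card ({1..n} - D) = card ({1..n} - E)"
    using sub fin by (simp add: card_Diff_subset)
  then obtain g where g: "bij_betw g ({1..n} - D) ({1..n} - E)"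
    using finite_same_card_bij by blast
  define \<sigma> where "\<sigma> = (\<lambda>i. if i \<in> D then (snd \<circ> inv_into X fst) i
                          else if i \<in> {1..n} then g i else i)"
  have "bij_betw \<sigma> D E"
    using f by (rule bij_betw_cong[THEN iffD1, rotated]) (simp add: \<sigma>_def)
  moreover have "bij_betw \<sigma> ({1..n} - D) ({1..n} - E)"
    using g by (rule bij_betw_cong[THEN iffD1, rotated]) (simp add: \<sigma>_def)
  ultimately have "bij_betw \<sigma> (D \<union> ({1..n} - D)) (E \<union> ({1..n} - E))"
    by (rule bij_betw_combine) auto
  then have "bij_betw \<sigma> {1..n} {1..n}" using sub by (simp add: Un_absorb1)
  then have "\<sigma> permutes {1..n}"
    by (rule bij_imp_permutes) (use sub in \<open>auto simp: \<sigma>_def\<close>)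
  moreover have "x \<in> perm_graph n \<sigma>" if "x \<in> X" for x
  proof -
    have "fst x \<in> D" "inv_into X fst (fst x) = x"
      using that assms by (auto simp: D_def partial_perm_def)
    then show ?thesis using sub by (auto simp: mem_perm_graph \<sigma>_def)
  qed
  ultimately show thesis using that[of \<sigma>] unfolding Sym_def by blast
qed

text \<open>If \<open>\<tau>\<close> also extends \<open>X\<close>, then
  \<open>\<tau> \<circ> inv \<sigma>\<close> fixes every value used by \<open>X\<close>. The
  extensions thus form a translate of a full symmetric group, which gives their number and makes the
  concentration bound applicable to them.\<close>

lemma extensions_eq_image:
  assumes "\<sigma> \<in> Sym n" "X \<subseteq> perm_graph n \<sigma>"
  shows "extensions n X = (\<lambda>p. p \<circ> \<sigma>) ` {p. p permutes ({1..n} - snd ` X)}"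
proof (intro equalityI subsetI)
  have \<sigma>: "\<sigma> permutes {1..n}" using assms by (simp add: Sym_def)
  {
    fix \<tau> assume "\<tau> \<in> extensions n X"
    then have \<tau>: "\<tau> permutes {1..n}" "X \<subseteq> perm_graph n \<tau>" by (auto simp: extensions_def Sym_def)
    have "\<tau> \<circ> inv \<sigma> permutes {1..n}"
      by (intro permutes_compose permutes_inv \<sigma> \<tau>)
    moreover have "(\<tau> \<circ> inv \<sigma>) j = j" if j: "j \<in> snd ` X" for j
    proof -
      obtain x where x: "x \<in> X" "j = snd x" using j by blast
      then have "\<sigma> (fst x) = j" "\<tau> (fst x) = j"
        using assms(2) \<tau>(2) mem_perm_graph by blast+
      then show ?thesis by (metis \<sigma> comp_apply permutes_inverses(2))
    qed
    ultimately have "\<tau> \<circ> inv \<sigma> permutes ({1..n} - snd ` X)"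
      by (rule permutes_superset) auto
    moreover have "\<tau> = (\<tau> \<circ> inv \<sigma>) \<circ> \<sigma>"
      by (simp add: comp_assoc permutes_inv_o(2)[OF \<sigma>])
    ultimately show "\<tau> \<in> (\<lambda>p. p \<circ> \<sigma>) ` {p. p permutes ({1..n} - snd ` X)}" by blast
  next
    fix \<tau> assume "\<tau> \<in> (\<lambda>p. p \<circ> \<sigma>) ` {p. p permutes ({1..n} - snd ` X)}"
    then obtain p where p: "p permutes ({1..n} - snd ` X)" "\<tau> = p \<circ> \<sigma>" by blast
    have "p permutes {1..n}" using permutes_subset[OF p(1)] by blast
    then have "\<tau> permutes {1..n}" using p(2) \<sigma> permutes_compose by blast
    moreover have "x \<in> perm_graph n \<tau>" if "x \<in> X" for x
    proof -
      have "fst x \<in> {1..n}" "\<sigma> (fst x) = snd x" using assms(2) that mem_perm_graph by blast+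
      moreover have "p (snd x) = snd x" using p(1) that by (auto simp: permutes_def)
      ultimately show ?thesis by (simp add: mem_perm_graph p(2))
    qed
    ultimately show "\<tau> \<in> extensions n X" by (auto simp: extensions_def Sym_def)
  }
qed

lemma inj_on_comp_right_permutes:
  assumes "\<sigma> \<in> Sym n"
  shows "inj_on (\<lambda>p :: nat \<Rightarrow> 'b. p \<circ> \<sigma>) A"
proof (rule inj_onI)
  have \<sigma>: "\<sigma> permutes {1..n}" using assms by (simp add: Sym_def)
  fix p q :: "nat \<Rightarrow> 'b" assume "p \<circ> \<sigma> = q \<circ> \<sigma>"
  then have "p \<circ> (\<sigma> \<circ> inv \<sigma>) = q \<circ> (\<sigma> \<circ> inv \<sigma>)" by (metis comp_assoc)
  then show "p = q" by (simp add: permutes_inv_o(1)[OF \<sigma>])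
qed

lemma card_range_complement:
  assumes "partial_perm n X"
  shows "card ({1..n} - snd ` X) = n - card X"
proof -
  have "snd ` X \<subseteq> {1..n}" "card (snd ` X) = card X" "finite (snd ` X)"
    using assms partial_perm_finite[OF assms] by (auto simp: partial_perm_def card_image)
  then show ?thesis by (simp add: card_Diff_subset)
qed

lemma card_extensions:
  assumes "partial_perm n X"
  shows "card (extensions n X) = fact (n - card X)"
proof -
  obtain \<sigma> where "\<sigma> \<in> Sym n" "X \<subseteq> perm_graph n \<sigma>" using partial_perm_extends[OF assms] .
  then show ?thesis
    using card_range_complement[OF assms]
    by (simp add: extensions_eq_image card_image inj_on_comp_right_permutes card_permutations)
qed

text \<open>Serves sets of pairs not known to be partial permutations, such as the covering triples:
  a set with an extension is a partial permutation, and otherwise the bound is trivial.\<close>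

lemma card_extensions_le:
  assumes "finite X"
  shows "card (extensions n X) \<le> fact (n - card X)"
proof (cases "extensions n X = {}")
  case False
  then obtain \<sigma> where "\<sigma> \<in> Sym n" "X \<subseteq> perm_graph n \<sigma>" by (auto simp: extensions_def)
  then have "partial_perm n X" using partial_perm_perm_graph partial_perm_subset by blast
  then show ?thesis by (simp add: card_extensions)
qed simp

section \<open>Agreements of an extension with a fixed partial permutation\<close>

text \<open>Double counting of the pairs of an extension and a \<open>j\<close>-subset
  \<open>Y\<close> of \<open>M\<close> inside its graph. As \<open>S \<union> M\<close> is a partial
  permutation, so is every \<open>S \<union> Y\<close>, and its extensions are counted
  exactly.\<close>

lemma sum_choose_card_Int_extensions:
  assumes pp: "partial_perm n (S \<union> M)" and disj: "S \<inter> M = {}"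
  shows "(\<Sum>\<sigma>\<in>extensions n S. card (perm_graph n \<sigma> \<inter> M) choose j)
           = (card M choose j) * fact (n - card S - j)"
proof -
  have fin: "finite M" "finite S" using partial_perm_finite[OF pp] by auto
  define J where "J = {Y. Y \<subseteq> M \<and> card Y = j}"
  have finJ: "finite J" unfolding J_def using fin by simp
  have "(\<Sum>\<sigma>\<in>extensions n S. card (perm_graph n \<sigma> \<inter> M) choose j)
      = (\<Sum>\<sigma>\<in>extensions n S. card {Y\<in>J. Y \<subseteq> perm_graph n \<sigma>})"
  proof (rule sum.cong[OF refl])
    fix \<sigma>
    have "{Y\<in>J. Y \<subseteq> perm_graph n \<sigma>} = {Y. Y \<subseteq> perm_graph n \<sigma> \<inter> M \<and> card Y = j}"
      by (auto simp: J_def)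
    then show "(card (perm_graph n \<sigma> \<inter> M) choose j) = card {Y\<in>J. Y \<subseteq> perm_graph n \<sigma>}"
      using n_subsets[of "perm_graph n \<sigma> \<inter> M" j] fin by simp
  qed
  also have "\<dots> = (\<Sum>Y\<in>J. card {\<sigma>\<in>extensions n S. Y \<subseteq> perm_graph n \<sigma>})"
    using sum.swap_restrict[OF finite_extensions[of n S] finJ, of "\<lambda>_ _. 1" "\<lambda>\<sigma> Y. Y \<subseteq> perm_graph n \<sigma>"]
    unfolding card_eq_sum .
  also have "\<dots> = (\<Sum>Y\<in>J. fact (n - card S - j))"
  proof (rule sum.cong[OF refl])
    fix Y assume Y: "Y \<in> J"
    have "{\<sigma>\<in>extensions n S. Y \<subseteq> perm_graph n \<sigma>} = extensions n (S \<union> Y)"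
      by (auto simp: extensions_def)
    moreover have "partial_perm n (S \<union> Y)"
      using pp Y by (auto intro: partial_perm_subset simp: J_def)
    moreover have "card (S \<union> Y) = card S + j"
      using Y disj fin by (subst card_Un_disjoint) (auto simp: J_def intro: finite_subset)
    ultimately show "card {\<sigma>\<in>extensions n S. Y \<subseteq> perm_graph n \<sigma>} = fact (n - card S - j)"
      by (simp add: card_extensions)
  qed
  also have "\<dots> = (card M choose j) * fact (n - card S - j)"
    using n_subsets[OF fin(1), of j] by (simp add: J_def)
  finally show ?thesis .
qed

text \<open>Truncated inclusion-exclusion: for positive \<open>X\<close> the left side telescopes by
  Pascal's rule to \<open>- ((X - 1) choose 3)\<close>.\<close>

lemma Bonferroni_zero:
  "1 - real (X choose 1) + real (X choose 2) - real (X choose 3) \<le> of_bool (X = 0)"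
proof (cases X)
  case (Suc Y)
  have "1 - real (X choose 1) + real (X choose 2) - real (X choose 3) = - real (Y choose 3)"
    by (simp add: Suc numeral_eq_Suc)
  then show ?thesis by (simp add: Suc)
qed (simp add: numeral_eq_Suc)

text \<open>The identity \<open>k * (X choose k) = X * ((X - 1) choose (k - 1))\<close> reduces this
  to the previous inequality for \<open>X - 1\<close>.\<close>

lemma Bonferroni_one:
  "real (X choose 1) - 2 * real (X choose 2) + 3 * real (X choose 3) - 4 * real (X choose 4)
     \<le> of_bool (X = 1)"
proof (cases X)
  case (Suc Y)
  have *: "real (Suc k) * real (X choose Suc k) = real X * real (Y choose k)" for k
    using Suc_times_binomial_eq[of Y k] by (metis Suc of_nat_mult mult.commute)
  have "real (X choose 1) - 2 * real (X choose 2) + 3 * real (X choose 3) - 4 * real (X choose 4)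
      = real X * (1 - real (Y choose 1) + real (Y choose 2) - real (Y choose 3))"
    using *[of 1] *[of 2] *[of 3] by (simp add: Suc algebra_simps numeral_eq_Suc)
  also have "\<dots> \<le> real X * of_bool (Y = 0)"
    by (intro mult_left_mono Bonferroni_zero) simp
  also have "\<dots> = of_bool (X = 1)" by (auto simp: Suc)
  finally show ?thesis .
qed (simp add: numeral_eq_Suc)

text \<open>Summing a Bonferroni inequality over all extensions bounds the count from below by an
  alternating sum of binomial moments; four moments suffice for a positive constant, both for
  \<open>r = 0\<close> and for \<open>r = 1\<close>.\<close>

lemma card_extensions_exact_Int_compatible:
  assumes pp: "partial_perm n (S \<union> M)" and disj: "S \<inter> M = {}" and r: "r \<le> 1"
    and big: "9/10 * (real n - real (card S)) \<le> real (card M) - 3" "3 < real n - real (card S)"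
  shows "fact (n - card S) / 10 \<le> real (card {\<sigma>\<in>extensions n S. card (perm_graph n \<sigma> \<inter> M) = r})"
proof -
  define N m where "N = n - card S" and "m = card M"
  have fin: "finite M" "finite S" using partial_perm_finite[OF pp] by auto
  have "card S + m \<le> n"
    using partial_perm_card_le[OF pp] card_Un_disjoint[OF fin(2,1) disj] by (simp add: m_def)
  then have mN: "m \<le> N" and N: "real N = real n - real (card S)" by (auto simp: N_def)
  then have N3: "3 < N" and m9: "9/10 * real N \<le> real m - 3" using big by (auto simp: m_def)
  define B where "B = (\<lambda>j. (\<Sum>\<sigma>\<in>extensions n S. real (card (perm_graph n \<sigma> \<inter> M) choose j)))"
  have B: "B j = real (m choose j) * fact (N - j)" for j
  proof -
    have "B j = real (\<Sum>\<sigma>\<in>extensions n S. card (perm_graph n \<sigma> \<inter> M) choose j)"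
      by (simp add: B_def)
    then show ?thesis
      unfolding sum_choose_card_Int_extensions[OF pp disj] by (simp add: m_def N_def)
  qed
  \<comment> \<open>Factorial moments of the number of agreements, nearly constant in \<open>j\<close> as for a Poisson variable of mean 1.\<close>
  define y where "y = (\<lambda>j. fact j * B j)"
  \<comment> \<open>The ratio of consecutive moments is \<open>(m - j) / (N - j)\<close>. The slack
    of 3 in \<open>big\<close> keeps it at least \<open>9/10\<close> up to \<open>j = 3\<close>,
    that is, up to the fourth moment.\<close>
  have step: "y (Suc j) \<le> y j" "9/10 * y j \<le> y (Suc j)" if j: "j \<le> 3" for j
  proof -
    have jm: "j < m" "j < N" using that m9 N3 mN by linarith+
    have "real (N - j) * y (Suc j) = real (m - j) * y j"
    proof -
      have "(m choose Suc j) * Suc j = (m choose j) * (m - j)"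
        by (metis binomial_absorb_comp mult.commute binomial_absorption)
      then have 1: "real (Suc j) * real (m choose Suc j) = real (m - j) * real (m choose j)"
        by (metis of_nat_mult mult.commute)
      have 2: "(fact (N - j) :: real) = real (N - j) * fact (N - Suc j)"
        using jm by (simp add: fact_reduce Suc_diff_Suc)
      have "real (N - j) * y (Suc j) = real (N - j) * (fact j * (real (Suc j) * real (m choose Suc j)) * fact (N - Suc j))"
        by (simp add: y_def B)
      also have "\<dots> = real (m - j) * (fact j * real (m choose j) * (real (N - j) * fact (N - Suc j)))"
        unfolding 1 by simp
      also have "\<dots> = real (m - j) * y j" by (simp add: y_def B 2)
      finally show ?thesis .
    qed
    then have eq: "y (Suc j) = real (m - j) / real (N - j) * y j"
      using jm by (simp add: field_simps)
    have y0: "0 \<le> y j" by (simp add: y_def B)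
    have "real (m - j) / real (N - j) \<le> 1" using jm mN by simp
    from mult_right_mono[OF this y0] show "y (Suc j) \<le> y j" by (simp add: eq)
    have "9/10 * real (N - j) \<le> real (m - j)" using m9 j jm by simp
    then have "9/10 \<le> real (m - j) / real (N - j)" using jm by (simp add: field_simps)
    from mult_right_mono[OF this y0] show "9/10 * y j \<le> y (Suc j)" by (simp add: eq)
  qed
  have y0: "y 0 = fact N" by (simp add: y_def B)
  have count: "real (card {\<sigma>\<in>extensions n S. card (perm_graph n \<sigma> \<inter> M) = r})
     = (\<Sum>\<sigma>\<in>extensions n S. of_bool (card (perm_graph n \<sigma> \<inter> M) = r))"
    by (simp add: Collect_conj_eq)
  have pos: "0 < y 0" by (simp add: y0)
  have y_B: "B 0 = y 0" "B 1 = y 1" "B 2 = y 2 / 2" "B 3 = y 3 / 6" "B 4 = y 4 / 24"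
    by (simp_all add: y_def fact_numeral)
  \<comment> \<open>For \<open>r = 0\<close> these ratios yield at least \<open>3/10\<close> of
    \<open>fact N\<close>, for \<open>r = 1\<close> at least \<open>27/100\<close>; both exceed the
    claimed tenth.\<close>
  note steps = step[of 0] step[of 1] step[of 2] step[of 3]
  have num: "Suc 0 = 1" "Suc 1 = 2" "Suc 2 = 3" "Suc 3 = 4" by simp_all
  consider "r = 0" | "r = 1" using r by linarith
  then have "fact N / 10 \<le> (\<Sum>\<sigma>\<in>extensions n S. of_bool (card (perm_graph n \<sigma> \<inter> M) = r) :: real)"
  proof cases
    case 1
    have "B 0 - B 1 + B 2 - B 3
       = (\<Sum>\<sigma>\<in>extensions n S. 1 - real (card (perm_graph n \<sigma> \<inter> M) choose 1)
          + real (card (perm_graph n \<sigma> \<inter> M) choose 2) - real (card (perm_graph n \<sigma> \<inter> M) choose 3))"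
      by (simp add: B_def sum.distrib sum_subtractf)
    also have "\<dots> \<le> (\<Sum>\<sigma>\<in>extensions n S. of_bool (card (perm_graph n \<sigma> \<inter> M) = r))"
      unfolding 1 by (intro sum_mono Bonferroni_zero)
    finally show ?thesis
      using steps pos unfolding y_B num y0[symmetric] by linarith
  next
    case 2
    have "B 1 - 2 * B 2 + 3 * B 3 - 4 * B 4
       = (\<Sum>\<sigma>\<in>extensions n S. real (card (perm_graph n \<sigma> \<inter> M) choose 1)
          - 2 * real (card (perm_graph n \<sigma> \<inter> M) choose 2)
          + 3 * real (card (perm_graph n \<sigma> \<inter> M) choose 3)
          - 4 * real (card (perm_graph n \<sigma> \<inter> M) choose 4))"
      by (simp add: B_def sum.distrib sum_subtractf sum_distrib_left)
    also have "\<dots> \<le> (\<Sum>\<sigma>\<in>extensions n S. of_bool (card (perm_graph n \<sigma> \<inter> M) = r))"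
      unfolding 2 by (intro sum_mono Bonferroni_one)
    finally show ?thesis
      using steps pos unfolding y_B num y0[symmetric] by linarith
  qed
  then show ?thesis unfolding count N_def .
qed

text \<open>Disjoint \<open>S\<close> and \<open>M\<close> may still share coordinates. At most 24
  pairs of \<open>M\<close> conflict with \<open>S\<close> in this way, and for
  \<open>n \<ge> 1000\<close> the rest of \<open>M\<close> is large enough for the compatible
  case.\<close>

lemma card_extensions_exact_Int:
  assumes S: "partial_perm n S" and M: "partial_perm n M" and disj: "S \<inter> M = {}"
    and r: "r \<le> 1" and cS: "card S \<le> 12" and cM: "n - 12 \<le> card M" and n: "1000 \<le> n"
  shows "fact (n - card S) / 10 \<le> real (card {\<sigma>\<in>extensions n S. card (perm_graph n \<sigma> \<inter> M) = r})"
proof -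
  have fin: "finite S" "finite M" using S M by (auto intro: partial_perm_finite)
  define M1 M2 where "M1 = {x\<in>M. fst x \<in> fst ` S}" and "M2 = {x\<in>M. snd x \<in> snd ` S}"
  \<comment> \<open>A pair of \<open>M\<close> sharing a coordinate with a pair of \<open>S\<close> differs from it, so it never occurs in an extension of \<open>S\<close>.\<close>
  define M' where "M' = M - (M1 \<union> M2)"
  have inj: "inj_on fst M" "inj_on snd M" "inj_on fst S" "inj_on snd S"
    using S M by (auto simp: partial_perm_def)
  have "card M1 = card (fst ` M1)"
    using inj(1) by (subst card_image) (auto simp: M1_def intro: inj_on_subset)
  also have "\<dots> \<le> card (fst ` S)" using fin by (intro card_mono) (auto simp: M1_def)
  also have "\<dots> \<le> 12" using cS inj by (simp add: card_image)
  finally have c1: "card M1 \<le> 12" .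
  have "card M2 = card (snd ` M2)"
    using inj(2) by (subst card_image) (auto simp: M2_def intro: inj_on_subset)
  also have "\<dots> \<le> card (snd ` S)" using fin by (intro card_mono) (auto simp: M2_def)
  also have "\<dots> \<le> 12" using cS inj by (simp add: card_image)
  finally have c2: "card M2 \<le> 12" .
  have "card M \<le> card (M' \<union> (M1 \<union> M2))" using fin by (intro card_mono) (auto simp: M'_def M1_def M2_def)
  also have "\<dots> \<le> card M' + (card M1 + card M2)"
    using card_Un_le[of M' "M1 \<union> M2"] card_Un_le[of M1 M2] by linarith
  finally have cM': "n - 36 \<le> card M'" using c1 c2 cM by linarith
  have pp: "partial_perm n (S \<union> M')"
    unfolding partial_perm_def inj_on_Un
  proof (intro conjI)
    show "S \<union> M' \<subseteq> {1..n} \<times> {1..n}" using S M by (auto simp: partial_perm_def M'_def)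
    show "inj_on fst M'" "inj_on snd M'" using inj by (auto simp: M'_def intro: inj_on_subset)
    show "inj_on fst S" "inj_on snd S" by (fact inj)+
    show "fst ` (S - M') \<inter> fst ` (M' - S) = {}" "snd ` (S - M') \<inter> snd ` (M' - S) = {}"
      by (auto simp: M'_def M1_def M2_def image_iff) force+
  qed
  have same: "perm_graph n \<sigma> \<inter> M = perm_graph n \<sigma> \<inter> M'" if \<sigma>: "\<sigma> \<in> extensions n S" for \<sigma>
  proof -
    have inj\<sigma>: "inj_on fst (perm_graph n \<sigma>)" "inj_on snd (perm_graph n \<sigma>)" and sub: "S \<subseteq> perm_graph n \<sigma>"
      using \<sigma> partial_perm_perm_graph[of \<sigma> n] by (auto simp: extensions_def partial_perm_def)
    have "x \<in> S" if "x \<in> perm_graph n \<sigma>" "x \<in> M1 \<union> M2" for x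
    proof -
      from that(2) consider s where "s \<in> S" "fst s = fst x" | s where "s \<in> S" "snd s = snd x"
        by (force simp: M1_def M2_def)
      then have "\<exists>s\<in>S. s = x"
        using inj_onD[OF inj\<sigma>(1)] inj_onD[OF inj\<sigma>(2)] sub that(1) by cases blast+
      then show ?thesis by blast
    qed
    moreover have "M1 \<union> M2 \<subseteq> M" by (auto simp: M1_def M2_def)
    ultimately show ?thesis using disj unfolding M'_def by blast
  qed
  have "{\<sigma>\<in>extensions n S. card (perm_graph n \<sigma> \<inter> M) = r}
      = {\<sigma>\<in>extensions n S. card (perm_graph n \<sigma> \<inter> M') = r}"
    using same by auto
  moreover have "S \<inter> M' = {}" using disj by (auto simp: M'_def)
  ultimately show ?thesis
    using card_extensions_exact_Int_compatible[OF pp _ r] cM' cS n by auto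
qed

section \<open>Spread families\<close>

text \<open>A union bound over \<open>T\<close>. It allows the agreements inside two bases to be
  fixed in advance while at least half of each spread family is kept.\<close>

lemma card_avoiding_ge_half:
  fixes w :: real
  assumes fin: "finite F" and T: "finite T" "card T \<le> 12" "12 * w \<le> 1/2" "0 \<le> w"
    and spread: "\<And>x. x \<in> T \<Longrightarrow> real (card {\<sigma>\<in>F. x \<in> perm_graph n \<sigma>}) \<le> w * card F"
  shows "real (card F) \<le> 2 * real (card {\<sigma>\<in>F. perm_graph n \<sigma> \<inter> T = {}})"
proof -
  have "F \<subseteq> {\<sigma>\<in>F. perm_graph n \<sigma> \<inter> T = {}} \<union> (\<Union>x\<in>T. {\<sigma>\<in>F. x \<in> perm_graph n \<sigma>})" by blast
  then have "card F \<le> card ({\<sigma>\<in>F. perm_graph n \<sigma> \<inter> T = {}} \<union> (\<Union>x\<in>T. {\<sigma>\<in>F. x \<in> perm_graph n \<sigma>}))"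
    using fin T by (intro card_mono) auto
  also have "\<dots> \<le> card {\<sigma>\<in>F. perm_graph n \<sigma> \<inter> T = {}} + (\<Sum>x\<in>T. card {\<sigma>\<in>F. x \<in> perm_graph n \<sigma>})"
    by (rule order_trans[OF card_Un_le add_left_mono[OF card_UN_le[OF T(1)]]])
  finally have "real (card F) \<le> real (card {\<sigma>\<in>F. perm_graph n \<sigma> \<inter> T = {}})
      + (\<Sum>x\<in>T. real (card {\<sigma>\<in>F. x \<in> perm_graph n \<sigma>}))"
    by (simp flip: of_nat_sum of_nat_add)
  also have "(\<Sum>x\<in>T. real (card {\<sigma>\<in>F. x \<in> perm_graph n \<sigma>})) \<le> (\<Sum>x\<in>T. w * card F)"
    by (intro sum_mono spread)
  also have "\<dots> = (real (card T) * w) * card F" by simp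
  also have "\<dots> \<le> (12 * w) * card F" using T by (intro mult_right_mono) auto
  also have "\<dots> \<le> 1/2 * card F" using T by (intro mult_right_mono) auto
  finally show ?thesis by linarith
qed

text \<open>Without such a pair the function \<open>h\<close> vanishes on \<open>F1'\<close>, while
  its mean is at least \<open>1/10\<close>. Each member of \<open>F1'\<close> then contributes at
  least \<open>exp (t / 10)\<close> to the exponential moment of the lower tail, and by
  \<open>exp_gap\<close> the total exceeds the bound of
  \<open>permutation_mgf_bound\<close>.\<close>

lemma exists_agree_once:
  fixes w t :: real
  assumes S1: "partial_perm n S1" "card S1 \<le> 12" and S2: "partial_perm n S2" "card S2 \<le> 12"
    and int: "card (S1 \<inter> S2) \<le> 1"
    and F1: "F1 \<subseteq> extensions n S1" "fact (n - card S1) \<le> real n ^ 12 * real (card F1)"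
    and F2: "F2 \<subseteq> extensions n S2" "F2 \<noteq> {}"
    and spread1: "\<And>x. x \<notin> S1 \<Longrightarrow> real (card {\<sigma>\<in>F1. x \<in> perm_graph n \<sigma>}) \<le> w * card F1"
    and spread2: "\<And>x. x \<notin> S2 \<Longrightarrow> real (card {\<sigma>\<in>F2. x \<in> perm_graph n \<sigma>}) \<le> w * card F2"
    and n: "1000 \<le> n" and w: "0 \<le> w" "12 * w \<le> 1/2" and t: "0 \<le> t" "16 * t * w \<le> 1"
    and exp_gap: "2 * real n ^ 12 * exp (256 * real n * w\<^sup>2 * t\<^sup>2) < exp (t / 10)"
  shows "\<exists>\<sigma>\<in>F1. \<exists>\<tau>\<in>F2. agree n \<sigma> \<tau> = 1"
proof (rule ccontr)
  assume contra: "\<not> ?thesis"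
  \<comment> \<open>A member of \<open>F1'\<close> and a member of \<open>F2'\<close> have exactly
    \<open>S1 \<inter> S2\<close> in common inside \<open>S1 \<union> S2\<close>, so
    \<open>r\<close> further agreements make exactly one.\<close>
  define r where "r = 1 - card (S1 \<inter> S2)"
  define F1' where "F1' = {\<sigma>\<in>F1. perm_graph n \<sigma> \<inter> (S2 - S1) = {}}"
  define F2' where "F2' = {\<sigma>\<in>F2. perm_graph n \<sigma> \<inter> (S1 - S2) = {}}"
  have fS: "finite S1" "finite S2" using S1 S2 by (auto intro: partial_perm_finite)
  have fF: "finite F1" "finite F2" using F1 F2 by (auto intro: finite_subset)
  then have fF': "finite F1'" "finite F2'" by (auto simp: F1'_def F2'_def)
  have half1: "real (card F1) \<le> 2 * real (card F1')"
    unfolding F1'_def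
    using fS S2(2) w spread1 card_mono[of S2 "S2 - S1"]
    by (intro card_avoiding_ge_half[where w = w] fF) auto
  have half2: "real (card F2) \<le> 2 * real (card F2')"
    unfolding F2'_def
    using fS S1(2) w spread2 card_mono[of S1 "S1 - S2"]
    by (intro card_avoiding_ge_half[where w = w] fF) auto
  have pos2: "0 < real (card F2')"
  proof -
    have "0 < real (card F2)" using F2(2) fF by (simp add: card_gt_0_iff)
    then show ?thesis using half2 by linarith
  qed
  \<comment> \<open>Pairs of \<open>S2\<close> are left out of the count because the spreadness of
    \<open>F2\<close> says nothing about them. This keeps \<open>h\<close> stable under
    transpositions on all extensions of \<open>S1\<close>, not only on \<open>F1'\<close>.\<close>
  define good where "good = (\<lambda>\<sigma> \<tau>. card (perm_graph n \<sigma> \<inter> (perm_graph n \<tau> - S2)) = r)"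
  define h where "h = (\<lambda>\<sigma>. real (card {\<tau>\<in>F2'. good \<sigma> \<tau>}) / card F2')"
  have h0: "h \<sigma> = 0" if \<sigma>: "\<sigma> \<in> F1'" for \<sigma>
  proof -
    have "\<not> good \<sigma> \<tau>" if \<tau>: "\<tau> \<in> F2'" for \<tau>
    proof
      assume "good \<sigma> \<tau>"
      moreover have "perm_graph n \<sigma> \<inter> perm_graph n \<tau>
          = (S1 \<inter> S2) \<union> (perm_graph n \<sigma> \<inter> (perm_graph n \<tau> - S2))"
        using \<sigma> \<tau> F1(1) F2(1) by (auto simp: F1'_def F2'_def extensions_def)
      moreover have "card ((S1 \<inter> S2) \<union> (perm_graph n \<sigma> \<inter> (perm_graph n \<tau> - S2)))
          = card (S1 \<inter> S2) + card (perm_graph n \<sigma> \<inter> (perm_graph n \<tau> - S2))"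
        using fS by (intro card_Un_disjoint) auto
      ultimately have "agree n \<sigma> \<tau> = 1"
        using int by (simp add: agree_eq_card_Int good_def r_def)
      then show False using contra \<sigma> \<tau> by (auto simp: F1'_def F2'_def)
    qed
    then have none: "{\<tau>\<in>F2'. good \<sigma> \<tau>} = {}" by blast
    show ?thesis unfolding h_def none by simp
  qed
  obtain \<sigma>0 where \<sigma>0: "\<sigma>0 \<in> Sym n" "S1 \<subseteq> perm_graph n \<sigma>0"
    using partial_perm_extends[OF S1(1)] .
  define V where "V = {1..n} - snd ` S1"
  have fV: "finite V" and cV: "card V = n - card S1"
    using card_range_complement[OF S1(1)] by (auto simp: V_def)
  have ext: "extensions n S1 = (\<lambda>p. p \<circ> \<sigma>0) ` {p. p permutes V}"
    unfolding V_def by (rule extensions_eq_image[OF \<sigma>0])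
  have inj: "inj_on (\<lambda>p. p \<circ> \<sigma>0) {p. p permutes V}"
    by (rule inj_on_comp_right_permutes[OF \<sigma>0(1)])
  have reindex: "(\<Sum>\<sigma>\<in>extensions n S1. f \<sigma>) = (\<Sum>p | p permutes V. f (p \<circ> \<sigma>0))" for f :: "_ \<Rightarrow> real"
    unfolding ext by (simp add: sum.reindex[OF inj])
  have lip: "\<bar>h ((transpose c d \<circ> p) \<circ> \<sigma>0) - h (p \<circ> \<sigma>0)\<bar> \<le> 8 * w"
    if p: "p permutes V" and cd: "c \<in> V" "d \<in> V" for p c d
  proof -
    define \<sigma> \<sigma>' where "\<sigma> = p \<circ> \<sigma>0" and "\<sigma>' = (transpose c d \<circ> p) \<circ> \<sigma>0"
    have "p permutes {1..n}" using permutes_subset[OF p] by (auto simp: V_def)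
    then have \<sigma>perm: "\<sigma> permutes {1..n}" using \<sigma>0(1) permutes_compose by (auto simp: \<sigma>_def Sym_def)
    define u v where "u = inv \<sigma> c" and "v = inv \<sigma> d"
    have uv: "\<sigma> u = c" "\<sigma> v = d" "\<And>i. \<sigma> i = c \<Longrightarrow> i = u" "\<And>i. \<sigma> i = d \<Longrightarrow> i = v"
      using permutes_inverses[OF \<sigma>perm] by (auto simp: u_def v_def)
    \<comment> \<open>Passing from \<open>\<sigma>\<close> to \<open>\<sigma>'\<close> alters the
      graph only in these four pairs. So only a \<open>\<tau>\<close> containing one of them outside
      \<open>S2\<close> can change its status: a fraction of at most \<open>4 * w\<close> of
      \<open>F2\<close>, hence \<open>8 * w\<close> relative to \<open>F2'\<close>.\<close>
    define D where "D = {(u, c), (v, d), (u, d), (v, c)}"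
    have \<sigma>': "\<sigma>' i = transpose c d (\<sigma> i)" for i by (simp add: \<sigma>_def \<sigma>'_def)
    have diff: "x \<in> D"
      if x: "x \<in> perm_graph n \<sigma> - perm_graph n \<sigma>' \<or> x \<in> perm_graph n \<sigma>' - perm_graph n \<sigma>" for x
    proof -
      have ne: "\<sigma> (fst x) \<noteq> \<sigma>' (fst x)" and val: "snd x = \<sigma> (fst x) \<or> snd x = \<sigma>' (fst x)"
        using x by (auto simp: mem_perm_graph)
      have "\<sigma> (fst x) = c \<or> \<sigma> (fst x) = d"
        using ne unfolding \<sigma>' by (metis transpose_apply_other)
      then have "fst x = u \<and> \<sigma> (fst x) = c \<or> fst x = v \<and> \<sigma> (fst x) = d"
        using uv(3,4) by metis
      then have "x = (u, c) \<or> x = (u, d) \<or> x = (v, d) \<or> x = (v, c)"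
        using val unfolding \<sigma>' by (auto simp: prod_eq_iff)
      then show ?thesis unfolding D_def by blast
    qed
    have same: "good \<sigma> \<tau> = good \<sigma>' \<tau>" if "perm_graph n \<tau> \<inter> (D - S2) = {}" for \<tau>
    proof -
      have "perm_graph n \<sigma> \<inter> (perm_graph n \<tau> - S2) = perm_graph n \<sigma>' \<inter> (perm_graph n \<tau> - S2)"
        using that diff by blast
      then show ?thesis by (simp add: good_def)
    qed
    define E where "E = (\<Union>x\<in>D - S2. {\<tau>\<in>F2. x \<in> perm_graph n \<tau>})"
    have fE: "finite E" using fF by (auto simp: E_def D_def)
    have "card D \<le> 4" unfolding D_def by (simp add: card_insert_if)
    then have cD: "card (D - S2) \<le> 4" using card_mono[of D "D - S2"] by (simp add: D_def)
    have "card E \<le> (\<Sum>x\<in>D - S2. card {\<tau>\<in>F2. x \<in> perm_graph n \<tau>})"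
      unfolding E_def by (rule card_UN_le) (simp add: D_def)
    then have "real (card E) \<le> (\<Sum>x\<in>D - S2. real (card {\<tau>\<in>F2. x \<in> perm_graph n \<tau>}))"
      by (simp flip: of_nat_sum)
    also have "\<dots> \<le> (\<Sum>x\<in>D - S2. w * card F2)" by (intro sum_mono spread2) auto
    also have "\<dots> = real (card (D - S2)) * (w * card F2)" by simp
    also have "\<dots> \<le> 4 * (w * card F2)" using cD w by (intro mult_right_mono) auto
    also have "\<dots> \<le> 4 * (w * (2 * card F2'))" using half2 w by (intro mult_left_mono) auto
    finally have cE: "real (card E) \<le> 8 * w * card F2'" by simp
    have le: "real (card {\<tau>\<in>F2'. good a \<tau>}) \<le> real (card {\<tau>\<in>F2'. good b \<tau>}) + real (card E)"
      if "\<And>\<tau>. perm_graph n \<tau> \<inter> (D - S2) = {} \<Longrightarrow> good a \<tau> = good b \<tau>" for a b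
    proof -
      have "{\<tau>\<in>F2'. good a \<tau>} \<subseteq> {\<tau>\<in>F2'. good b \<tau>} \<union> E"
        using that by (auto simp: E_def F2'_def)
      then have "card {\<tau>\<in>F2'. good a \<tau>} \<le> card ({\<tau>\<in>F2'. good b \<tau>} \<union> E)"
        using fF' fE by (intro card_mono) auto
      also have "\<dots> \<le> card {\<tau>\<in>F2'. good b \<tau>} + card E" by (rule card_Un_le)
      finally show ?thesis by simp
    qed
    have "\<bar>real (card {\<tau>\<in>F2'. good \<sigma>' \<tau>}) - real (card {\<tau>\<in>F2'. good \<sigma> \<tau>})\<bar> \<le> 8 * w * card F2'"
      using le[of \<sigma> \<sigma>'] le[of \<sigma>' \<sigma>] same cE by fastforce
    moreover have "h \<sigma>' - h \<sigma> = (real (card {\<tau>\<in>F2'. good \<sigma>' \<tau>}) - real (card {\<tau>\<in>F2'. good \<sigma> \<tau>})) / card F2'"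
      by (simp add: h_def diff_divide_distrib)
    ultimately show ?thesis
      using pos2 unfolding \<sigma>_def[symmetric] \<sigma>'_def[symmetric] by (simp add: divide_le_eq)
  qed
  define \<mu> where "\<mu> = (\<Sum>p | p permutes V. h (p \<circ> \<sigma>0)) / fact (card V)"
  \<comment> \<open>The two sums are interchanged: for each fixed \<open>\<tau>\<close> in
    \<open>F2'\<close>, at least a tenth of the extensions of \<open>S1\<close> are good.\<close>
  have "fact (card V) / 10 \<le> (\<Sum>\<sigma>\<in>extensions n S1. h \<sigma>)"
  proof -
    have lower: "fact (card V) / 10 \<le> real (card {\<sigma>\<in>extensions n S1. good \<sigma> \<tau>})" if \<tau>: "\<tau> \<in> F2'" for \<tau>
    proof -
      have \<tau>': "\<tau> \<in> Sym n" "S2 \<subseteq> perm_graph n \<tau>" "perm_graph n \<tau> \<inter> (S1 - S2) = {}"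
        using \<tau> F2(1) by (auto simp: F2'_def extensions_def)
      show ?thesis unfolding good_def cV
      proof (rule card_extensions_exact_Int)
        show "partial_perm n (perm_graph n \<tau> - S2)"
          using partial_perm_perm_graph[OF \<tau>'(1)] partial_perm_subset by blast
        show "n - 12 \<le> card (perm_graph n \<tau> - S2)"
          using \<tau>'(2) S2(2) fS by (simp add: card_Diff_subset)
        show "S1 \<inter> (perm_graph n \<tau> - S2) = {}" using \<tau>'(3) by blast
      qed (use S1 n in \<open>auto simp: r_def\<close>)
    qed
    have "(\<Sum>\<sigma>\<in>extensions n S1. h \<sigma>) = (\<Sum>\<sigma>\<in>extensions n S1. real (card {\<tau>\<in>F2'. good \<sigma> \<tau>})) / card F2'"
      by (simp add: h_def sum_divide_distrib)
    also have "(\<Sum>\<sigma>\<in>extensions n S1. real (card {\<tau>\<in>F2'. good \<sigma> \<tau>}))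
        = (\<Sum>\<tau>\<in>F2'. real (card {\<sigma>\<in>extensions n S1. good \<sigma> \<tau>}))"
      using sum.swap_restrict[OF finite_extensions[of n S1] fF'(2), of "\<lambda>_ _. 1::real" good]
      by simp
    finally have eq: "(\<Sum>\<sigma>\<in>extensions n S1. h \<sigma>)
        = (\<Sum>\<tau>\<in>F2'. real (card {\<sigma>\<in>extensions n S1. good \<sigma> \<tau>})) / card F2'" .
    have "(\<Sum>\<tau>\<in>F2'. fact (card V) / 10) \<le> (\<Sum>\<tau>\<in>F2'. real (card {\<sigma>\<in>extensions n S1. good \<sigma> \<tau>}))"
      by (intro sum_mono lower)
    then show ?thesis unfolding eq using pos2 by (simp add: le_divide_eq mult.commute)
  qed
  then have mean: "1/10 \<le> \<mu>"
    unfolding \<mu>_def reindex[symmetric] by (simp add: le_divide_eq)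
  \<comment> \<open>The negative exponent addresses the lower tail. The Lipschitz constant
    \<open>8 * w\<close> produces the constant \<open>256 = 4 * 8\<^sup>2\<close> of
    \<open>exp_gap\<close>.\<close>
  have mgf: "(\<Sum>p | p permutes V. exp (- t * (h (p \<circ> \<sigma>0) - \<mu>)))
      \<le> fact (card V) * exp (4 * card V * (8 * w)\<^sup>2 * (- t)\<^sup>2)"
    unfolding \<mu>_def
    by (rule permutation_mgf_bound[where h = "\<lambda>p. h (p \<circ> \<sigma>0)"]) (use fV w t lip in auto)
  have "real (card F1') * exp (t / 10) \<le> (\<Sum>\<sigma>\<in>F1'. exp (- t * (h \<sigma> - \<mu>)))"
  proof -
    have "t / 10 \<le> t * \<mu>" using mult_left_mono[OF mean t(1)] by simp
    then have "real (card F1') * exp (t / 10) \<le> real (card F1') * exp (t * \<mu>)"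
      by (intro mult_left_mono) auto
    then show ?thesis by (simp add: h0)
  qed
  also have "\<dots> \<le> (\<Sum>\<sigma>\<in>extensions n S1. exp (- t * (h \<sigma> - \<mu>)))"
    using F1(1) by (intro sum_mono2) (auto simp: F1'_def)
  also have "\<dots> = (\<Sum>p | p permutes V. exp (- t * (h (p \<circ> \<sigma>0) - \<mu>)))"
    by (rule reindex)
  also note mgf
  also have "fact (card V) * exp (4 * card V * (8 * w)\<^sup>2 * (- t)\<^sup>2)
      \<le> fact (card V) * exp (256 * real n * w\<^sup>2 * t\<^sup>2)"
  proof -
    have "real (card V) * (256 * w\<^sup>2 * t\<^sup>2) \<le> real n * (256 * w\<^sup>2 * t\<^sup>2)"
      by (intro mult_right_mono) (auto simp: cV)
    then show ?thesis by (simp add: power_mult_distrib mult_ac)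
  qed
  also have "\<dots> \<le> (real n ^ 12 * (2 * real (card F1'))) * exp (256 * real n * w\<^sup>2 * t\<^sup>2)"
  proof (rule mult_right_mono)
    have "fact (card V) \<le> real n ^ 12 * real (card F1)" using F1(2) by (simp add: cV)
    also have "\<dots> \<le> real n ^ 12 * (2 * real (card F1'))" by (intro mult_left_mono half1) auto
    finally show "fact (card V) \<le> real n ^ 12 * (2 * real (card F1'))" .
  qed auto
  also have "\<dots> = real (card F1') * (2 * real n ^ 12 * exp (256 * real n * w\<^sup>2 * t\<^sup>2))" by simp
  finally have "real (card F1') * exp (t / 10)
      \<le> real (card F1') * (2 * real n ^ 12 * exp (256 * real n * w\<^sup>2 * t\<^sup>2))" .
  moreover have "0 < real (card F1')"
  proof -
    have "0 < real (card F1)"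
      using F1(2) fact_gt_zero[of "n - card S1", where 'a = real] by (cases "card F1 = 0") auto
    then show ?thesis using half1 by linarith
  qed
  ultimately show False using exp_gap by simp
qed

section \<open>Existence of spread subfamilies by density increment\<close>

text \<open>The bounds are those that the density increment delivers for a family of at least
  \<open>fact n / n ^ 4\<close> members: \<open>n ^ 12\<close> is \<open>n ^ 4\<close> times the
  further loss \<open>1 / w ^ 12 \<le> n ^ 8\<close>.\<close>

definition spread_base :: "nat \<Rightarrow> real \<Rightarrow> (nat \<Rightarrow> nat) set \<Rightarrow> (nat \<times> nat) set \<Rightarrow> bool" where
  "spread_base n w A S \<longleftrightarrow> partial_perm n S \<and> card S \<le> 12 \<and>
     (\<exists>F. F \<subseteq> A \<and> F \<subseteq> extensions n S \<and> F \<noteq> {} \<and> fact (n - card S) \<le> real n ^ 12 * real (card F) \<and>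
        (\<forall>x. x \<notin> S \<longrightarrow> real (card {\<sigma>\<in>F. x \<in> perm_graph n \<sigma>}) \<le> w * card F))"

lemma spread_base_mono: "spread_base n w A S \<Longrightarrow> A \<subseteq> B \<Longrightarrow> spread_base n w B S"
  unfolding spread_base_def by (meson order_trans)

lemma power_half_mult_fact_le:
  "2 * k \<le> n \<Longrightarrow> (real n / 2) ^ k * fact (n - k) \<le> (fact n :: real)"
proof (induction k)
  case (Suc k)
  have "(fact (n - k) :: real) = real (n - k) * fact (n - Suc k)"
    using Suc.prems by (simp add: fact_reduce Suc_diff_Suc)
  moreover have "real n / 2 \<le> real (n - k)" using Suc.prems by simp
  ultimately have "real n / 2 * fact (n - Suc k) \<le> (fact (n - k) :: real)"
    by (simp add: mult_right_mono)
  then have "(real n / 2) ^ k * (real n / 2 * fact (n - Suc k)) \<le> (real n / 2) ^ k * fact (n - k)"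
    by (intro mult_left_mono) auto
  also have "\<dots> \<le> fact n" using Suc by simp
  finally show ?case by (simp only: power_Suc mult_ac)
qed simp

text \<open>Among the sets of at most 13 pairs that lie in at least the fraction
  \<open>w ^ card S\<close> of the members of \<open>A\<close>, one of maximal size works: a further
  pair occurring in a fraction \<open>w\<close> of the members containing it could be added.\<close>

lemma spread_base_exists:
  fixes w :: real
  assumes A: "A \<subseteq> Sym n" and large: "fact n \<le> real n ^ 4 * real (card A)"
    and w: "0 < w" "w \<le> 1" "real n ^ 4 < (real n * w / 2) ^ 13" "1 \<le> real n ^ 8 * w ^ 12"
    and n: "26 \<le> n"
  shows "\<exists>S. spread_base n w A S"
proof -
  have finA: "finite A" using A finite_Sym finite_subset by blast
  \<comment> \<open>The bound 13 makes a maximal such \<open>S\<close> available; size 13 itself is excluded by counting extensions.\<close>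
  define P where "P = (\<lambda>S. finite S \<and> card S \<le> 13 \<and>
    w ^ card S * real (card A) \<le> real (card {\<sigma>\<in>A. S \<subseteq> perm_graph n \<sigma>}))"
  have P0: "P {}" by (simp add: P_def)
  have "\<forall>S. P S \<longrightarrow> card S < 14" by (auto simp: P_def)
  from ex_has_greatest_nat[of P, OF P0 this]
  obtain S where S: "P S" and max: "\<And>T. P T \<Longrightarrow> card T \<le> card S" by blast
  define F where "F = {\<sigma>\<in>A. S \<subseteq> perm_graph n \<sigma>}"
  have finS: "finite S" and cS: "card S \<le> 13" and F_large: "w ^ card S * real (card A) \<le> real (card F)"
    using S by (auto simp: P_def F_def)
  have Apos: "0 < real (card A)"
    using large fact_gt_zero[of n, where 'a = real] by (cases "card A = 0") auto
  have "0 < w ^ card S * real (card A)" using Apos w by simp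
  then have "0 < real (card F)" using F_large by linarith
  then have F_ne: "F \<noteq> {}" by auto
  have F_ext: "F \<subseteq> extensions n S" using A by (auto simp: F_def extensions_def)
  obtain \<sigma> where "\<sigma> \<in> F" using F_ne by blast
  then have pp: "partial_perm n S"
    using A partial_perm_subset[OF partial_perm_perm_graph] by (auto simp: F_def)
  have "card S \<noteq> 13"
  proof
    assume 13: "card S = 13"
    have "card F \<le> fact (n - 13)"
      using card_mono[OF finite_extensions F_ext] card_extensions[OF pp] by (simp add: 13)
    then have cF: "real (card F) \<le> fact (n - 13)" by (metis of_nat_fact of_nat_le_iff)
    have "w ^ 13 * ((real n / 2) ^ 13 * fact (n - 13)) \<le> w ^ 13 * fact n"
      using power_half_mult_fact_le[of 13 n] n w by (intro mult_left_mono) auto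
    also have "\<dots> \<le> w ^ 13 * (real n ^ 4 * real (card A))"
      using large w by (intro mult_left_mono) auto
    also have "\<dots> = real n ^ 4 * (w ^ 13 * real (card A))" by simp
    also have "\<dots> \<le> real n ^ 4 * fact (n - 13)"
      using F_large cF by (intro mult_left_mono) (auto simp: 13)
    finally have "(real n * w / 2) ^ 13 * fact (n - 13) \<le> real n ^ 4 * fact (n - 13)"
      by (simp add: power_mult_distrib power_divide mult_ac)
    then show False using w(3) by simp
  qed
  then have cS12: "card S \<le> 12" using cS by simp
  have spread: "real (card {\<sigma>\<in>F. x \<in> perm_graph n \<sigma>}) \<le> w * card F" if x: "x \<notin> S" for x
  proof -
    \<comment> \<open>As \<open>card S \<le> 12\<close>, the set \<open>insert x S\<close> still
      respects the size bound 13, so it can violate \<open>P\<close> only by its density.\<close>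
    have "\<not> P (insert x S)" using max[of "insert x S"] x finS by auto
    then have "real (card {\<sigma>\<in>A. insert x S \<subseteq> perm_graph n \<sigma>}) < w ^ Suc (card S) * real (card A)"
      using x finS cS12 by (auto simp: P_def)
    also have "\<dots> = w * (w ^ card S * real (card A))" by simp
    also have "\<dots> \<le> w * card F" using F_large w by (intro mult_left_mono) auto
    also have "{\<sigma>\<in>A. insert x S \<subseteq> perm_graph n \<sigma>} = {\<sigma>\<in>F. x \<in> perm_graph n \<sigma>}" by (auto simp: F_def)
    finally show ?thesis by simp
  qed
  have "fact (n - card S) \<le> (fact n :: real)" by (intro fact_mono) auto
  also have "\<dots> \<le> real n ^ 4 * real (card A) * 1" using large by simp
  also have "\<dots> \<le> real n ^ 4 * real (card A) * (real n ^ 8 * w ^ 12)"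
    using w by (intro mult_left_mono) auto
  also have "\<dots> = real n ^ 12 * (w ^ 12 * real (card A))"
    by (simp add: mult.assoc flip: power_add)
  also have "\<dots> \<le> real n ^ 12 * (w ^ card S * real (card A))"
    using power_decreasing[OF cS12, of w] w by (intro mult_left_mono mult_right_mono) auto
  also have "\<dots> \<le> real n ^ 12 * real (card F)" using F_large by (intro mult_left_mono) auto
  finally have "fact (n - card S) \<le> real n ^ 12 * real (card F)" .
  then have "spread_base n w A S"
    unfolding spread_base_def using pp cS12 F_ext F_ne spread by (auto intro!: exI[of _ F] simp: F_def)
  then show ?thesis ..
qed

section \<open>Bounded sets meeting pairwise in two elements\<close>

text \<open>
  A member contains two elements \<open>x, y\<close> of a fixed member; since it also meets \<open>U x y\<close>, a member not
  containing both, in two elements, it contains a third one \<open>z\<close> from there.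
\<close>

lemma two_intersecting_cover:
  assumes "\<And>S. S \<in> G \<Longrightarrow> finite S \<and> card S \<le> k"
    and int: "\<And>S T. S \<in> G \<Longrightarrow> T \<in> G \<Longrightarrow> 2 \<le> card (S \<inter> T)"
  obtains (common) e where "card e = 2" "\<And>S. S \<in> G \<Longrightarrow> e \<subseteq> S"
  | (triples) \<T> where "finite \<T>" "card \<T> \<le> k ^ 3" "\<And>T. T \<in> \<T> \<Longrightarrow> card T = 3"
      "\<And>S. S \<in> G \<Longrightarrow> \<exists>T\<in>\<T>. T \<subseteq> S"
proof (cases "G = {} \<or> (\<exists>e. card e = 2 \<and> (\<forall>S\<in>G. e \<subseteq> S))")
  case True
  then show ?thesis
  proof
    \<comment> \<open>The empty family takes the second alternative, with no triples, since the
      element type need not have two elements to form \<open>e\<close>.\<close>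
    assume "G = {}"
    then show ?thesis by (intro triples[of "{}"]) auto
  next
    assume "\<exists>e. card e = 2 \<and> (\<forall>S\<in>G. e \<subseteq> S)"
    then show ?thesis using common by blast
  qed
next
  case False
  then obtain S0 where S0: "S0 \<in> G" by blast
  have "\<exists>S\<in>G. \<not> {x, y} \<subseteq> S" if "x \<noteq> y" for x y
    using False that by (metis card_2_iff)
  then obtain U where U: "\<And>x y. x \<noteq> y \<Longrightarrow> U x y \<in> G" "\<And>x y. x \<noteq> y \<Longrightarrow> \<not> {x, y} \<subseteq> U x y"
    by metis
  define \<T> where "\<T> = (\<Union>x\<in>S0. \<Union>y\<in>S0 - {x}. (\<lambda>z. {x, y, z}) ` (U x y - {x, y}))"
  have fin: "finite S" "card S \<le> k" if "S \<in> G" for S using assms(1)[OF that] by auto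
  show ?thesis
  proof (rule triples)
    show "finite \<T>" unfolding \<T>_def using fin S0 U(1) by auto
    show "card T = 3" if T: "T \<in> \<T>" for T
    proof -
      obtain x y z where "T = {x, y, z}" "y \<noteq> x" "z \<noteq> x" "z \<noteq> y" using T by (auto simp: \<T>_def)
      then show ?thesis by simp
    qed
    have "card ((\<lambda>z. {x, y, z}) ` (U x y - {x, y})) \<le> k" if "x \<noteq> y" for x y
      using card_image_le[of "U x y - {x, y}" "\<lambda>z. {x, y, z}"]
        card_mono[of "U x y" "U x y - {x, y}"] fin[OF U(1)[OF that]] by fastforce
    then have "card (\<Union>y\<in>S0 - {x}. (\<lambda>z. {x, y, z}) ` (U x y - {x, y})) \<le> k * k" for x
    proof -
      assume *: "\<And>x y. x \<noteq> y \<Longrightarrow> card ((\<lambda>z. {x, y, z}) ` (U x y - {x, y})) \<le> k"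
      have "card (\<Union>y\<in>S0 - {x}. (\<lambda>z. {x, y, z}) ` (U x y - {x, y}))
          \<le> (\<Sum>y\<in>S0 - {x}. card ((\<lambda>z. {x, y, z}) ` (U x y - {x, y})))"
        using fin[OF S0] by (intro card_UN_le) auto
      also have "\<dots> \<le> (\<Sum>y\<in>S0 - {x}. k)" by (intro sum_mono *) auto
      also have "\<dots> = card (S0 - {x}) * k" by simp
      also have "\<dots> \<le> k * k"
        using fin[OF S0] card_mono[of S0 "S0 - {x}"] by (intro mult_right_mono) auto
      finally show ?thesis .
    qed
    then have "(\<Sum>x\<in>S0. card (\<Union>y\<in>S0 - {x}. (\<lambda>z. {x, y, z}) ` (U x y - {x, y}))) \<le> (\<Sum>x\<in>S0. k * k)"
      by (intro sum_mono)
    also have "\<dots> \<le> k * (k * k)" using fin[OF S0] by simp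
    finally show "card \<T> \<le> k ^ 3"
      using card_UN_le[OF fin(1)[OF S0], of "\<lambda>x. \<Union>y\<in>S0 - {x}. (\<lambda>z. {x, y, z}) ` (U x y - {x, y})"]
      by (simp add: \<T>_def power3_eq_cube)
  next
    fix S assume S: "S \<in> G"
    have "\<exists>e. e \<subseteq> S \<inter> S0 \<and> card e = 2"
      using int[OF S S0] by (metis obtain_subset_with_card_n)
    then obtain x y where xy: "x \<noteq> y" "x \<in> S" "y \<in> S" "x \<in> S0" "y \<in> S0"
      by (auto simp: card_2_iff)
    have "\<not> S \<inter> U x y \<subseteq> {x, y}"
    proof
      assume "S \<inter> U x y \<subseteq> {x, y}"
      then have "S \<inter> U x y \<subset> {x, y}" using U(2)[OF xy(1)] by blast
      then have "card (S \<inter> U x y) < card {x, y}" by (intro psubset_card_mono) auto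
      then show False using int[OF S U(1)[OF xy(1)]] xy(1) by simp
    qed
    then obtain z where "z \<in> S" "z \<in> U x y - {x, y}" by blast
    then show "\<exists>T\<in>\<T>. T \<subseteq> S"
      using xy by (intro bexI[of _ "{x, y, z}"]) (auto simp: \<T>_def)
  qed
qed

text \<open>For \<open>w = n powr (-3/5)\<close> and \<open>t = n powr (1/10)\<close> one has
  \<open>n * w\<^sup>2 * t\<^sup>2 = 1\<close>, so concentration loses only the constant
  \<open>exp 256\<close>, while \<open>exp (t / 10)\<close> outgrows every power of
  \<open>n\<close>. Also \<open>n * w = n powr (2/5)\<close>, whose 13th power
  \<open>n powr (26/5)\<close> beats \<open>n ^ 4\<close>, and
  \<open>w ^ 12 = n powr (-36/5)\<close> stays above \<open>n powr (-8)\<close>.\<close>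

lemma eventually_parameters:
  "\<forall>\<^sub>F n in sequentially. 12 * (real n powr (-3/5)) \<le> 1/2
     \<and> 16 * (real n powr (1/10)) * (real n powr (-3/5)) \<le> 1
     \<and> 2 * real n ^ 12 * exp (256 * real n * (real n powr (-3/5))\<^sup>2 * (real n powr (1/10))\<^sup>2)
          < exp (real n powr (1/10) / 10)
     \<and> real n powr (-3/5) \<le> 1
     \<and> real n ^ 4 < (real n * (real n powr (-3/5)) / 2) ^ 13
     \<and> 1 \<le> real n ^ 8 * (real n powr (-3/5)) ^ 12
     \<and> 4000 \<le> n"
proof (intro eventually_conj)
  have "\<forall>\<^sub>F n in sequentially. 2 * real n ^ 12 * exp 256 < exp (real n powr (1/10) / 10)"
    by real_asymp
  moreover have "\<forall>\<^sub>F n::nat in sequentially. 0 < n" by (rule eventually_gt_at_top)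
  ultimately show "\<forall>\<^sub>F n in sequentially.
     2 * real n ^ 12 * exp (256 * real n * (real n powr (-3/5))\<^sup>2 * (real n powr (1/10))\<^sup>2)
          < exp (real n powr (1/10) / 10)"
  proof eventually_elim
    case (elim n)
    have "real n * (real n powr (-3/5))\<^sup>2 * (real n powr (1/10))\<^sup>2
        = real n powr 1 * (real n powr (-3/5) * real n powr (-3/5)) * (real n powr (1/10) * real n powr (1/10))"
      using elim by (simp add: power2_eq_square)
    also have "\<dots> = 1" using elim by (simp only: powr_add[symmetric]) simp
    finally show ?case using elim by (simp add: mult.assoc)
  qed
  show "\<forall>\<^sub>F n::nat in sequentially. 4000 \<le> n" by (rule eventually_ge_at_top)
qed real_asymp+

section \<open>Families without a single agreement\<close>

theorem theorem1p2:
  shows "\<exists>n0::nat. \<forall>n\<ge>n0. \<forall>A. A \<subseteq> Sym n \<longrightarrow>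
           (\<forall>\<sigma>\<in>A. \<forall>\<tau>\<in>A. \<sigma> \<noteq> \<tau> \<longrightarrow> agree n \<sigma> \<tau> \<noteq> 1) \<longrightarrow>
           card A \<le> fact (n - 2) \<and> (card A = fact (n - 2) \<longrightarrow> two_coset n A)"
proof -
  obtain n0 where n0: "\<And>n. n0 \<le> n \<Longrightarrow> 12 * (real n powr (-3/5)) \<le> 1/2
     \<and> 16 * (real n powr (1/10)) * (real n powr (-3/5)) \<le> 1
     \<and> 2 * real n ^ 12 * exp (256 * real n * (real n powr (-3/5))\<^sup>2 * (real n powr (1/10))\<^sup>2)
          < exp (real n powr (1/10) / 10)
     \<and> real n powr (-3/5) \<le> 1
     \<and> real n ^ 4 < (real n * (real n powr (-3/5)) / 2) ^ 13
     \<and> 1 \<le> real n ^ 8 * (real n powr (-3/5)) ^ 12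
     \<and> 4000 \<le> n"
    using eventually_parameters unfolding eventually_sequentially by blast
  have main: "card A \<le> fact (n - 2) \<and> (card A = fact (n - 2) \<longrightarrow> two_coset n A)"
    if "n0 \<le> n" and A: "A \<subseteq> Sym n"
      and avoid: "\<And>\<sigma> \<tau>. \<sigma> \<in> A \<Longrightarrow> \<tau> \<in> A \<Longrightarrow> \<sigma> \<noteq> \<tau> \<Longrightarrow> agree n \<sigma> \<tau> \<noteq> 1" for n A
  proof -
    define w t where "w = real n powr (-3/5)" and "t = real n powr (1/10)"
    note par = n0[OF \<open>n0 \<le> n\<close>, folded w_def t_def]
    have n: "4000 \<le> n" using par by blast
    have w: "0 < w" and t: "0 \<le> t" using n by (auto simp: w_def t_def)
    have finA: "finite A" using A finite_Sym finite_subset by blast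
    \<comment> \<open>A permutation agrees with itself in \<open>n\<close> points and
      \<open>n\<close> is not 1, so the two members supplied by \<open>exists_agree_once\<close> may
      coincide.\<close>
    have avoid': "agree n \<sigma> \<tau> \<noteq> 1" if "\<sigma> \<in> A" "\<tau> \<in> A" for \<sigma> \<tau>
      using avoid[OF that] n by (cases "\<sigma> = \<tau>") (auto simp: agree_eq_card_Int)
    define G where "G = {S. spread_base n w A S}"
    \<comment> \<open>The case \<open>S = T\<close> is included, so every base has at least two
      pairs.\<close>
    have G_int: "2 \<le> card (S \<inter> T)" if ST: "S \<in> G" "T \<in> G" for S T
    proof (rule ccontr)
      assume "\<not> 2 \<le> card (S \<inter> T)"
      then have small: "card (S \<inter> T) \<le> 1" by simp
      from ST(1) obtain F1 where F1: "partial_perm n S" "card S \<le> 12" "F1 \<subseteq> A" "F1 \<subseteq> extensions n S"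
        "fact (n - card S) \<le> real n ^ 12 * real (card F1)"
        "\<And>x. x \<notin> S \<Longrightarrow> real (card {\<sigma>\<in>F1. x \<in> perm_graph n \<sigma>}) \<le> w * card F1"
        unfolding G_def spread_base_def by blast
      from ST(2) obtain F2 where F2: "partial_perm n T" "card T \<le> 12" "F2 \<subseteq> A" "F2 \<subseteq> extensions n T" "F2 \<noteq> {}"
        "\<And>x. x \<notin> T \<Longrightarrow> real (card {\<sigma>\<in>F2. x \<in> perm_graph n \<sigma>}) \<le> w * card F2"
        unfolding G_def spread_base_def by blast
      have "\<exists>\<sigma>\<in>F1. \<exists>\<tau>\<in>F2. agree n \<sigma> \<tau> = 1"
        using exists_agree_once[OF F1(1,2) F2(1,2) small F1(4,5) F2(4,5) F1(6) F2(6), of t] par n w t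
        by auto
      then show False using avoid' F1(3) F2(3) by blast
    qed
    define R where "R = {\<sigma>\<in>A. \<forall>S\<in>G. \<not> S \<subseteq> perm_graph n \<sigma>}"
    have R_sub: "R \<subseteq> A" by (auto simp: R_def)
    \<comment> \<open>Otherwise \<open>R\<close> itself would have a spread base. This would also be
      a base for \<open>A\<close>, and it would lie in a member of \<open>R\<close>, which by
      definition contains no base.\<close>
    have R_small: "real n ^ 4 * real (card R) < fact n"
    proof (rule ccontr)
      assume "\<not> ?thesis"
      then obtain S where S: "spread_base n w R S"
        using spread_base_exists[of R n w] R_sub A par w n by auto
      then have "S \<in> G" using spread_base_mono R_sub by (auto simp: G_def)
      moreover obtain \<sigma> where "\<sigma> \<in> R" "S \<subseteq> perm_graph n \<sigma>"
        using S by (auto simp: spread_base_def extensions_def)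
      ultimately show False by (auto simp: R_def)
    qed
    \<comment> \<open>Of the factor \<open>n ^ 4\<close>, one \<open>n\<^sup>2\<close> pays for
      passing from \<open>fact n\<close> to \<open>fact (n - 2)\<close>, and the other is far above
      1000.\<close>
    have cR: "1000 * real (card R) \<le> fact (n - 2)"
    proof -
      have "fact n = real n * (real (n - 1) * fact (n - 2))"
      proof -
        obtain m where "n = Suc (Suc m)" using n le_Suc_ex[of 2 n] by auto
        then show ?thesis by simp
      qed
      also have "\<dots> \<le> real n * (real n * fact (n - 2))" by (intro mult_left_mono mult_right_mono) auto
      finally have "real n ^ 4 * real (card R) < real n ^ 2 * fact (n - 2)"
        using R_small by (simp add: power2_eq_square)
      then have "real n ^ 2 * (real n ^ 2 * real (card R)) < real n ^ 2 * fact (n - 2)"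
        by (simp add: power2_eq_square power4_eq_xxxx mult.assoc)
      then have *: "real n ^ 2 * real (card R) < fact (n - 2)"
        by (rule mult_left_less_imp_less) simp
      have "1000 * 1 \<le> real n * real n" using n by (intro mult_mono) auto
      then have "1000 * real (card R) \<le> real n ^ 2 * real (card R)"
        by (intro mult_right_mono) (auto simp: power2_eq_square)
      then show ?thesis using * by linarith
    qed
    have fpos: "(0::real) < fact (n - 2)" by simp
    have strict: ?thesis if "real (card A) < fact (n - 2)"
    proof -
      have "real (card A) < real (fact (n - 2))" using that by simp
      then have "card A < fact (n - 2)" by (simp only: of_nat_less_iff)
      then show ?thesis by simp
    qed
    have G_fin: "finite S \<and> card S \<le> 12" if "S \<in> G" for S
      using that partial_perm_finite by (auto simp: G_def spread_base_def)
    show ?thesis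
    proof (rule two_intersecting_cover[OF G_fin G_int])
      \<comment> \<open>Outside \<open>R\<close> there are at most \<open>12 ^ 3 = 1728\<close>
        times \<open>fact (n - 3)\<close> members, which is at most half of
        \<open>fact (n - 2)\<close> because \<open>n - 2 \<ge> 3456\<close>.\<close>
      fix \<T> :: "(nat \<times> nat) set set"
      assume \<T>: "finite \<T>" "card \<T> \<le> 12 ^ 3" "\<And>T. T \<in> \<T> \<Longrightarrow> card T = 3"
        "\<And>S. S \<in> G \<Longrightarrow> \<exists>T\<in>\<T>. T \<subseteq> S"
      have "A \<subseteq> R \<union> (\<Union>T\<in>\<T>. extensions n T)"
      proof
        fix \<sigma> assume \<sigma>: "\<sigma> \<in> A"
        show "\<sigma> \<in> R \<union> (\<Union>T\<in>\<T>. extensions n T)"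
        proof (cases "\<sigma> \<in> R")
          case False
          then obtain S where "S \<in> G" "S \<subseteq> perm_graph n \<sigma>" using \<sigma> by (auto simp: R_def)
          then obtain T where "T \<in> \<T>" "T \<subseteq> perm_graph n \<sigma>" using \<T>(4) by blast
          then show ?thesis using \<sigma> A by (auto simp: extensions_def)
        qed simp
      qed
      then have "card A \<le> card (R \<union> (\<Union>T\<in>\<T>. extensions n T))"
        using \<T>(1) finite_subset[OF R_sub finA] by (intro card_mono) auto
      also have "\<dots> \<le> card R + (\<Sum>T\<in>\<T>. card (extensions n T))"
        by (rule order_trans[OF card_Un_le add_left_mono[OF card_UN_le[OF \<T>(1)]]])
      also have "(\<Sum>T\<in>\<T>. card (extensions n T)) \<le> (\<Sum>T\<in>\<T>. fact (n - 3))"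
      proof (rule sum_mono)
        fix T assume "T \<in> \<T>"
        then have T: "card T = 3" by (rule \<T>(3))
        then have "finite T" by (metis card.infinite zero_neq_numeral)
        then show "card (extensions n T) \<le> fact (n - 3)" using card_extensions_le[of T n] T by simp
      qed
      also have "\<dots> \<le> 1728 * fact (n - 3)" using \<T>(2) by simp
      finally have "card A \<le> card R + 1728 * fact (n - 3)" by simp
      then have "real (card A) \<le> real (card R + 1728 * fact (n - 3))" by (simp only: of_nat_le_iff)
      then have 1: "real (card A) \<le> real (card R) + 1728 * fact (n - 3)" by simp
      have "(fact (n - 2) :: real) = real (n - 2) * fact (n - 3)"
      proof -
        obtain m where "n = Suc (Suc (Suc m))" using n le_Suc_ex[of 3 n] by (auto simp: numeral_3_eq_3)
        then show ?thesis by simp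
      qed
      moreover have "3456 * fact (n - 3) \<le> real (n - 2) * fact (n - 3)"
        using n by (intro mult_right_mono) auto
      ultimately have "real (card A) < fact (n - 2)" using 1 cR fpos by linarith
      then show ?thesis by (rule strict)
    next
      fix e :: "(nat \<times> nat) set"
      assume e: "card e = 2" "\<And>S. S \<in> G \<Longrightarrow> e \<subseteq> S"
      have fin_e: "finite e" using e(1) by (metis card.infinite zero_neq_numeral)
      have ext_le: "card (extensions n e) \<le> fact (n - 2)"
        using card_extensions_le[OF fin_e] e(1) by metis
      show ?thesis
      proof (cases "A \<subseteq> extensions n e")
        case True
        have "card A \<le> card (extensions n e)" using True by (intro card_mono) auto
        moreover have "two_coset n A" if "card A = fact (n - 2)"
        proof -
          have Aeq: "A = extensions n e"
            using card_seteq[OF finite_extensions True] that ext_le by simp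
          obtain i j k l where ijkl: "e = {(i, j), (k, l)}" "(i, j) \<noteq> (k, l)"
            using e(1) by (auto simp: card_2_iff)
          \<comment> \<open>A member of \<open>A\<close> contains both pairs of \<open>e\<close>,
            which forces \<open>e\<close> to be a partial permutation and gives the distinctness
            that a 2-coset demands.\<close>
          have "A \<noteq> {}" using that by (metis card.empty fact_nonzero)
          then obtain \<sigma> where \<sigma>: "\<sigma> \<in> Sym n" "e \<subseteq> perm_graph n \<sigma>"
            by (auto simp: Aeq extensions_def)
          have pp: "partial_perm n e"
            using partial_perm_subset[OF partial_perm_perm_graph[OF \<sigma>(1)] \<sigma>(2)] .
          then have rng: "i \<in> {1..n}" "j \<in> {1..n}" "k \<in> {1..n}" "l \<in> {1..n}"
            and ne: "i \<noteq> k" "j \<noteq> l"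
            using ijkl by (auto simp: partial_perm_def)
          have "A = {\<sigma> \<in> Sym n. \<sigma> i = j \<and> \<sigma> k = l}"
            unfolding Aeq extensions_def using ijkl(1) rng by (auto simp: mem_perm_graph)
          then show ?thesis unfolding two_coset_def using rng ne by blast
        qed
        ultimately show ?thesis using ext_le by simp
      next
        case False
        \<comment> \<open>At least a tenth of the extensions of \<open>e\<close>, if there are any,
          agree with this \<open>\<sigma>\<close> exactly once and are therefore missing from
          \<open>A\<close>; together with the thousandth allowed for \<open>R\<close> this leaves
          \<open>A\<close> strictly below \<open>fact (n - 2)\<close>.\<close>
        then obtain \<sigma> where \<sigma>: "\<sigma> \<in> A" "\<sigma> \<notin> extensions n e" by blast
        then have \<sigma>S: "\<sigma> \<in> Sym n" and not_sub: "\<not> e \<subseteq> perm_graph n \<sigma>"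
          using A by (auto simp: extensions_def)
        \<comment> \<open>A member outside \<open>R\<close> contains a base, and every base contains
          \<open>e\<close>.\<close>
        have "A \<subseteq> R \<union> (A \<inter> extensions n e)"
          using e(2) A by (auto simp: R_def extensions_def)
        then have "card A \<le> card (R \<union> (A \<inter> extensions n e))"
          using finA finite_subset[OF R_sub finA] by (intro card_mono) auto
        also have "\<dots> \<le> card R + card (A \<inter> extensions n e)" by (rule card_Un_le)
        finally have cA: "real (card A) \<le> real (card R) + real (card (A \<inter> extensions n e))" by simp
        have "real (card (A \<inter> extensions n e)) \<le> 9/10 * fact (n - 2)"
        proof (cases "extensions n e = {}")
          case False
          then obtain \<rho> where \<rho>: "\<rho> \<in> Sym n" "e \<subseteq> perm_graph n \<rho>" by (auto simp: extensions_def)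
          have pp: "partial_perm n e"
            using partial_perm_subset[OF partial_perm_perm_graph[OF \<rho>(1)] \<rho>(2)] .
          have "e \<inter> perm_graph n \<sigma> \<subset> e" using not_sub by blast
          then have "card (e \<inter> perm_graph n \<sigma>) < card e" by (rule psubset_card_mono[OF fin_e])
          then have lt: "card (e \<inter> perm_graph n \<sigma>) \<le> 1" using e(1) by simp
          \<comment> \<open>Since \<open>\<sigma>\<close> misses a pair of \<open>e\<close>, it
            contains at most one of the two; \<open>r\<close> is the number of agreements outside
            \<open>e\<close> that then makes one in total.\<close>
          define r where "r = 1 - card (e \<inter> perm_graph n \<sigma>)"
          define B where "B = {\<tau>\<in>extensions n e. card (perm_graph n \<tau> \<inter> (perm_graph n \<sigma> - e)) = r}"
          have "fact (n - card e) / 10 \<le> real (card B)"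
            unfolding B_def
          proof (rule card_extensions_exact_Int[OF pp])
            show "partial_perm n (perm_graph n \<sigma> - e)"
              using partial_perm_perm_graph[OF \<sigma>S] partial_perm_subset by blast
            show "n - 12 \<le> card (perm_graph n \<sigma> - e)"
              using diff_card_le_card_Diff[OF fin_e, of "perm_graph n \<sigma>"] e(1) by simp
          qed (use n e in \<open>auto simp: r_def\<close>)
          then have cB: "fact (n - 2) / 10 \<le> real (card B)" by (simp add: e(1))
          have "\<tau> \<notin> A" if \<tau>: "\<tau> \<in> B" for \<tau>
          proof
            assume "\<tau> \<in> A"
            have "perm_graph n \<tau> \<inter> perm_graph n \<sigma>
                = (e \<inter> perm_graph n \<sigma>) \<union> (perm_graph n \<tau> \<inter> (perm_graph n \<sigma> - e))"
              using \<tau> by (auto simp: B_def extensions_def)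
            also have "card \<dots> = card (e \<inter> perm_graph n \<sigma>) + card (perm_graph n \<tau> \<inter> (perm_graph n \<sigma> - e))"
              by (intro card_Un_disjoint) auto
            also have "\<dots> = 1" using \<tau> lt by (simp add: B_def r_def)
            finally show False using avoid'[OF \<open>\<tau> \<in> A\<close> \<sigma>(1)] by (simp add: agree_eq_card_Int)
          qed
          then have "A \<inter> extensions n e \<subseteq> extensions n e - B" by blast
          then have "card (A \<inter> extensions n e) \<le> card (extensions n e - B)"
            by (intro card_mono) auto
          also have "\<dots> = card (extensions n e) - card B"
            by (intro card_Diff_subset) (auto simp: B_def)
          finally have "real (card (A \<inter> extensions n e)) \<le> real (card (extensions n e)) - real (card B)"
            using card_mono[OF finite_extensions, of B n e] by (auto simp: B_def)
          moreover have "real (card (extensions n e)) = fact (n - 2)"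
            using card_extensions[OF pp] by (simp add: e(1))
          ultimately show ?thesis using cB by linarith
        qed simp
        then have "real (card A) < fact (n - 2)" using cA cR fpos by linarith
        then show ?thesis by (rule strict)
      qed
    qed
  qed
  show ?thesis
  proof (intro exI[of _ n0] allI impI)
    fix n A
    assume "n0 \<le> n" "A \<subseteq> Sym n" "\<forall>\<sigma>\<in>A. \<forall>\<tau>\<in>A. \<sigma> \<noteq> \<tau> \<longrightarrow> agree n \<sigma> \<tau> \<noteq> 1"
    then show "card A \<le> fact (n - 2) \<and> (card A = fact (n - 2) \<longrightarrow> two_coset n A)"
      by (intro main) blast+
  qed
qed

end
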